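(* Let $A\in\mathbb{C}_{n,n}$ with $\mathrm{Ind}(A)=k$, and let $A=A_1+A_2$ be the core-EP decomposition of $A$. If the $\mathfrak{m}$-core-EP inverse $A^{(\mathrm{E})}$ of $A$ exists, then $$A^{(\mathrm{E})}=A_1^{(\mathrm{m})},$$ where $A_1^{(\mathrm{m})}$ is the $\mathfrak{m}$-core inverse of $A_1$.
   Context: $\mathbb{C}_{n,n}$ is the set of $n\times n$ complex matrices; $A^*$, $\mathrm{rk}(A)$, $\mathcal{R}(A)$ denote conjugate transpose, rank and column space. $\mathrm{Ind}(A)$ is the smallest positive integer $k$ with $\mathrm{rk}(A^{k+1})=\mathrm{rk}(A^k)$. The Minkowski metric matrix is $G=\begin{bmatrix}1&0\\ 0&-I_{n-1}\end{bmatrix}$ and the Minkowski adjoint of $A$ is $A^{\sim}=GA^*G$. Core-EP decomposition (known): every $A\in\mathbb{C}_{n,n}$ with $\mathrm{Ind}(A)=k$, $\mathrm{rk}(A^k)=r$ can be written uniquely as $A=A_1+A_2$ with $\mathrm{rk}(A_1^2)=\mathrm{rk}(A_1)$, $A_2^k=0$, $A_1^*A_2=A_2A_1=0$; moreover there is a unitary $U$ with $A_1=U\begin{bmatrix}T&S\\ 0&0\end{bmatrix}U^*$ and $A_2=U\begin{bmatrix}0&0\\ 0&N\end{bmatrix}U^*$, where $T\in\mathbb{C}_{r,r}$ is invertible and $N^k=0$. For $A$ with $\mathrm{Ind}(A)=k$, the $\mathfrak{m}$-core-EP inverse $A^{(\mathrm{E})}$ of $A$ is the matrix $X\in\mathbb{C}_{n,n}$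 (unique if it exists) satisfying $XAX=X$, $XA^{k+1}=A^k$, $(AX)^{\sim}=AX$ and $\mathcal{R}(X)\subseteq\mathcal{R}(A^k)$. For $B\in\mathbb{C}_{n,n}$ with $\mathrm{rk}(B^2)=\mathrm{rk}(B)$, the $\mathfrak{m}$-core inverse $B^{(\mathrm{m})}$ is the matrix $X$ (unique if it exists) satisfying $BXB=B$, $BX^2=X$, $(BX)^{\sim}=BX$; it exists if and only if $\mathrm{rk}(B^{\sim}B)=\mathrm{rk}(B)$. *)

theory Defs
  imports
    "HOL.Complex"
    "Jordan_Normal_Form.Schur_Decomposition"
    "Jordan_Normal_Form.DL_Rank"
begin

definition mat_Ind :: "nat \<Rightarrow> complex mat \<Rightarrow> nat" where
  "mat_Ind n A = (LEAST k. 0 < k \<and> vec_space.rank n (A ^\<^sub>m (k + 1)) = vec_space.rank n (A ^\<^sub>m k))"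

definition minkowski_metric :: "nat \<Rightarrow> complex mat" where
  "minkowski_metric n = mat n n (\<lambda>(i, j). if i \<noteq> j then 0 else if i = 0 then 1 else - 1)"

definition minkowski_adjoint :: "nat \<Rightarrow> complex mat \<Rightarrow> complex mat" where
  "minkowski_adjoint n A = minkowski_metric n * mat_adjoint A * minkowski_metric n"

definition core_EP_decomposition :: "nat \<Rightarrow> complex mat \<Rightarrow> complex mat \<Rightarrow> complex mat \<Rightarrow> bool" where
  "core_EP_decomposition n A A1 A2 \<longleftrightarrow>
     A1 \<in> carrier_mat n n \<and> A2 \<in> carrier_mat n n \<and> A = A1 + A2 \<and>
     vec_space.rank n (A1 ^\<^sub>m 2) = vec_space.rank n A1 \<and>
     A2 ^\<^sub>m mat_Ind n A = 0\<^sub>m n n \<and>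
     mat_adjoint A1 * A2 = 0\<^sub>m n n \<and> A2 * A1 = 0\<^sub>m n n"

definition is_m_core_EP_inverse :: "nat \<Rightarrow> complex mat \<Rightarrow> complex mat \<Rightarrow> bool" where
  "is_m_core_EP_inverse n A X \<longleftrightarrow>
     X \<in> carrier_mat n n \<and>
     X * A * X = X \<and>
     X * A ^\<^sub>m (mat_Ind n A + 1) = A ^\<^sub>m mat_Ind n A \<and>
     minkowski_adjoint n (A * X) = A * X \<and>
     vec_space.col_space n X \<subseteq> vec_space.col_space n (A ^\<^sub>m mat_Ind n A)"

(* Like m_core_inverse below, meaningful only if such a matrix exists;
   it is then unique, as shown at the end of this theory. *)
definition m_core_EP_inverse :: "nat \<Rightarrow> complex mat \<Rightarrow> complex mat" where
  "m_core_EP_inverse n A = (THE X. is_m_core_EP_inverse n A X)"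

definition is_m_core_inverse :: "nat \<Rightarrow> complex mat \<Rightarrow> complex mat \<Rightarrow> bool" where
  "is_m_core_inverse n B X \<longleftrightarrow>
     vec_space.rank n (B ^\<^sub>m 2) = vec_space.rank n B \<and>
     X \<in> carrier_mat n n \<and>
     B * X * B = B \<and>
     B * X ^\<^sub>m 2 = X \<and>
     minkowski_adjoint n (B * X) = B * X"

definition m_core_inverse :: "nat \<Rightarrow> complex mat \<Rightarrow> complex mat" where
  "m_core_inverse n B = (THE X. is_m_core_inverse n B X)"

lemma mat_adjoint_carrier [simp]:
  "A \<in> carrier_mat n m \<Longrightarrow> mat_adjoint A \<in> carrier_mat m n"
  unfolding mat_adjoint_def by auto

lemma mat_adjoint_index:
  fixes A :: "complex mat"
  assumes "A \<in> carrier_mat n m" "i < m" "j < n"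
  shows "mat_adjoint A $$ (i, j) = cnj (A $$ (j, i))"
  using assms unfolding mat_adjoint_def by (simp add: mat_of_rows_index)

lemma mat_adjoint_mult:
  fixes A B :: "complex mat"
  assumes A: "A \<in> carrier_mat n n" and B: "B \<in> carrier_mat n n"
  shows "mat_adjoint (A * B) = mat_adjoint B * mat_adjoint A"
proof (rule eq_matI)
  note AB = mult_carrier_mat[OF A B] mat_adjoint_carrier[OF A] mat_adjoint_carrier[OF B]
  fix i j assume "i < dim_row (mat_adjoint B * mat_adjoint A)"
    and "j < dim_col (mat_adjoint B * mat_adjoint A)"
  hence ij: "i < n" "j < n" using AB by auto
  have "mat_adjoint (A * B) $$ (i, j) = cnj ((A * B) $$ (j, i))"
    by (rule mat_adjoint_index[OF AB(1) ij])
  also have "\<dots> = (\<Sum>k = 0..<n. mat_adjoint B $$ (i, k) * mat_adjoint A $$ (k, j))"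
    using A B ij by (simp add: scalar_prod_def mat_adjoint_index[OF A] mat_adjoint_index[OF B] mult.commute)
  also have "\<dots> = (mat_adjoint B * mat_adjoint A) $$ (i, j)"
    using AB ij by (simp add: scalar_prod_def)
  finally show "mat_adjoint (A * B) $$ (i, j) = (mat_adjoint B * mat_adjoint A) $$ (i, j)" .
qed (use mat_adjoint_carrier[OF A] mat_adjoint_carrier[OF B] mat_adjoint_carrier[OF mult_carrier_mat[OF A B]] in auto)

lemma minkowski_metric_carrier [simp]: "minkowski_metric n \<in> carrier_mat n n"
  unfolding minkowski_metric_def by simp

lemma minkowski_metric_square: "minkowski_metric n * minkowski_metric n = 1\<^sub>m n"
proof (rule eq_matI)
  fix i j assume "i < dim_row (1\<^sub>m n :: complex mat)" "j < dim_col (1\<^sub>m n :: complex mat)"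
  hence ij: "i < n" "j < n" by auto
  have "(minkowski_metric n * minkowski_metric n) $$ (i, j)
      = (\<Sum>k = 0..<n. minkowski_metric n $$ (i, k) * minkowski_metric n $$ (k, j))"
    using ij by (simp add: scalar_prod_def minkowski_metric_def)
  also have "\<dots> = (\<Sum>k = 0..<n. if k = i then (if i = j then 1 else 0) else 0)"
    using ij by (intro sum.cong) (auto simp: minkowski_metric_def)
  finally show "(minkowski_metric n * minkowski_metric n) $$ (i, j) = 1\<^sub>m n $$ (i, j)"
    using ij by simp
qed (simp_all add: minkowski_metric_def)

lemma minkowski_adjoint_mult:
  assumes A: "A \<in> carrier_mat n n" and B: "B \<in> carrier_mat n n"
  shows "minkowski_adjoint n (A * B) = minkowski_adjoint n B * minkowski_adjoint n A"
proof -
  define G where "G = minkowski_metric n"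
  have G: "G \<in> carrier_mat n n" and GG: "G * G = 1\<^sub>m n"
    unfolding G_def by (simp_all add: minkowski_metric_square)
  note A' = mat_adjoint_carrier[OF A] and B' = mat_adjoint_carrier[OF B]
  have "G * (G * (mat_adjoint A * G)) = (G * G) * (mat_adjoint A * G)"
    using G A' by (intro assoc_mult_mat[symmetric, of _ n n _ n _ n]) auto
  hence "G * (G * (mat_adjoint A * G)) = mat_adjoint A * G"
    using G A' by (simp add: GG)
  hence "minkowski_adjoint n B * minkowski_adjoint n A
      = G * (mat_adjoint B * (mat_adjoint A * G))"
    unfolding minkowski_adjoint_def G_def[symmetric] using G A' B' by (simp add: assoc_mult_mat[of _ n n _ n _ n])
  also have "\<dots> = G * (mat_adjoint B * mat_adjoint A) * G"
    using G A' B' by (simp add: assoc_mult_mat[of _ n n _ n _ n])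
  finally show ?thesis
    unfolding minkowski_adjoint_def G_def[symmetric] mat_adjoint_mult[OF A B] ..
qed

lemma minkowski_projectors_eq:
  assumes P: "P \<in> carrier_mat n n" "minkowski_adjoint n P = P"
    and Q: "Q \<in> carrier_mat n n" "minkowski_adjoint n Q = Q"
    and PQ: "P * Q = Q" and QP: "Q * P = P"
  shows "P = Q"
  using minkowski_adjoint_mult[OF P(1) Q(1)] assms by simp

lemma col_space_fixed:
  fixes M B Y :: "complex mat"
  assumes M: "M \<in> carrier_mat n n" and B: "B \<in> carrier_mat n n" and Y: "Y \<in> carrier_mat n n"
    and MB: "M * B = B" and sub: "vec_space.col_space n Y \<subseteq> vec_space.col_space n B"
  shows "M * Y = Y"
proof (rule mat_col_eqI)
  fix j assume "j < dim_col Y"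
  hence j: "j < n" using Y by simp
  have "Y *\<^sub>v unit_vec n j = col Y j" using Y j by (intro eq_vecI) auto
  hence "col Y j \<in> vec_space.col_space n Y"
    using Y j by (auto simp: vec_space.col_space_eq[OF Y] intro!: bexI[of _ "unit_vec n j"])
  then obtain x where x: "x \<in> carrier_vec n" "B *\<^sub>v x = col Y j"
    using sub B by (auto simp: vec_space.col_space_eq[OF B])
  have "col (M * Y) j = M *\<^sub>v col Y j" using M Y j by (intro col_mult2) auto
  also have "\<dots> = (M * B) *\<^sub>v x" using M B x by (simp flip: x(2))
  also have "\<dots> = col Y j" using MB x by simp
  finally show "col (M * Y) j = col Y j" .
qed (use M Y in auto)

lemma m_core_EP_inverse_unique:
  assumes A: "A \<in> carrier_mat n n"
    and "is_m_core_EP_inverse n A X" "is_m_core_EP_inverse n A Y"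
  shows "X = Y"
proof -
  define k where "k = mat_Ind n A"
  have Ak: "A ^\<^sub>m k \<in> carrier_mat n n" using A by simp
  have comm: "A ^\<^sub>m i * A = A * A ^\<^sub>m i" for i
  proof (induction i)
    case (Suc i)
    have "A ^\<^sub>m Suc i * A = (A * A ^\<^sub>m i) * A" using Suc by simp
    also have "\<dots> = A * (A ^\<^sub>m i * A)" using A by (intro assoc_mult_mat[of _ n n _ n _ n]) auto
    finally show ?case by simp
  qed (use A in simp)
  hence pow: "A ^\<^sub>m (k + 1) = A * A ^\<^sub>m k" by simp
  have absorb: "X * A * Y = Y"
    if X: "is_m_core_EP_inverse n A X" and Y: "is_m_core_EP_inverse n A Y" for X Y
  proof (rule col_space_fixed[of _ n "A ^\<^sub>m k"])
    show "X * A * A ^\<^sub>m k = A ^\<^sub>m k"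
      using X A Ak assoc_mult_mat[of X n n A n "A ^\<^sub>m k" n]
      unfolding is_m_core_EP_inverse_def k_def[symmetric] pow by simp
  qed (use X Y A Ak in \<open>auto simp: is_m_core_EP_inverse_def k_def\<close>)
  have carr: "X \<in> carrier_mat n n" "Y \<in> carrier_mat n n"
    and self: "minkowski_adjoint n (A * X) = A * X" "minkowski_adjoint n (A * Y) = A * Y"
    using assms unfolding is_m_core_EP_inverse_def by auto
  have eq: "A * X = A * Y"
  proof (rule minkowski_projectors_eq)
    show "A * X * (A * Y) = A * Y" "A * Y * (A * X) = A * X"
      using absorb[OF assms(2,3)] absorb[OF assms(3,2)] A carr
      by (simp_all add: assoc_mult_mat[of _ n n _ n _ n])
  qed (use A carr self in auto)
  have "Y = X * (A * Y)" using absorb[OF assms(2,3)] A carr by simp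
  also have "\<dots> = X * (A * X)" using eq by simp
  also have "\<dots> = X" using absorb[OF assms(2,2)] A carr by simp
  finally show ?thesis ..
qed

lemma m_core_inverse_unique:
  assumes B: "B \<in> carrier_mat n n"
    and "is_m_core_inverse n B X" "is_m_core_inverse n B Y"
  shows "X = Y"
proof -
  have square: "X ^\<^sub>m 2 = X * X" if "X \<in> carrier_mat n n" for X :: "complex mat"
    using that by (simp add: numeral_2_eq_2)
  note assoc = assoc_mult_mat[of _ n n _ n _ n]
  have facts: "X \<in> carrier_mat n n" "B * X * B = B" "B * X * X = X"
    "minkowski_adjoint n (B * X) = B * X" if "is_m_core_inverse n B X" for X
    using that B unfolding is_m_core_inverse_def by (auto simp: square assoc)
  have proj: "X * B * (B * X) = B * X" if "is_m_core_inverse n B X" for X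
  proof -
    note X = facts[OF that]
    define P where "P = B * X"
    define Q where "Q = 1\<^sub>m n - P"
    have c: "X \<in> carrier_mat n n" "P \<in> carrier_mat n n" "Q \<in> carrier_mat n n"
      using B X(1) unfolding P_def Q_def by auto
    note c' = B c mult_carrier_mat[of _ n n _ n]
    note left = minus_mult_distrib_mat[of "1\<^sub>m n" n n P]
      and right = mult_minus_distrib_mat[of _ n n "1\<^sub>m n" n P]
    have PB: "P * B = B" and PX: "P * X = X" and BX: "B * X = P"
      using X unfolding P_def by auto
    have PP: "P * P = P"
      using assoc_mult_mat[OF c(2) B c(1)] PB BX by simp
    have QP: "Q * P = 0\<^sub>m n n" and QB: "Q * B = 0\<^sub>m n n" and QX: "Q * X = 0\<^sub>m n n"
      unfolding Q_def using B c by (simp_all add: left PP PB PX)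
    have PQ: "P * Q = 0\<^sub>m n n" unfolding Q_def using c by (simp add: right PP)
    have QQ: "Q * Q = Q"
    proof -
      have "Q * Q = Q * 1\<^sub>m n - Q * P" using c right[of Q] by (simp add: Q_def)
      also have "\<dots> = Q" unfolding QP using c by (intro eq_matI) auto
      finally show ?thesis .
    qed
    have sum: "P + Q = 1\<^sub>m n" unfolding Q_def using c by (intro eq_matI) auto
    have mult4: "(M1 * P + Q) * (M2 * P + Q) = M1 * (P * M2) * P + M1 * (P * Q) + (Q * M2) * P + Q * Q"
      if "M1 \<in> carrier_mat n n" "M2 \<in> carrier_mat n n" for M1 M2
    proof -
      have assocs: "M1 * P * (M2 * P) = M1 * (P * M2) * P" "Q * (M2 * P) = Q * M2 * P"
          "M1 * P * Q = M1 * (P * Q)"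
        using that c' by (simp_all add: assoc)
      have "(M1 * P + Q) * (M2 * P + Q) = (M1 * P + Q) * (M2 * P) + (M1 * P + Q) * Q"
        using that c' by (intro mult_add_distrib_mat) auto
      also have "\<dots> = (M1 * P * (M2 * P) + Q * (M2 * P)) + (M1 * P * Q + Q * Q)"
        using that c' by (simp add: add_mult_distrib_mat[of _ n n _ _ n])
      also have "\<dots> = M1 * P * (M2 * P) + M1 * P * Q + Q * (M2 * P) + Q * Q"
      proof -
        have "(a + b) + (c + d) = a + c + b + d"
          if "a \<in> carrier_mat n n" "b \<in> carrier_mat n n" "c \<in> carrier_mat n n" "d \<in> carrier_mat n n"
          for a b c d :: "complex mat"
          using that by (intro eq_matI) (auto simp: algebra_simps)
        note rearrange = this
        show ?thesis by (rule rearrange) (use that c' in auto)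
      qed
      finally show ?thesis by (simp only: assocs)
    qed
    have "(B * P + Q) * (X * P + Q) = 1\<^sub>m n"
      using B c by (simp add: mult4 PX PQ QX QQ BX PP sum)
    hence "(X * P + Q) * (B * P + Q) = 1\<^sub>m n"
      using B c by (intro mat_mult_left_right_inverse[of "B * P + Q" n "X * P + Q"]) auto
    hence "X * B * P + Q = P + Q"
      using B c by (simp add: mult4 PB PQ QB QQ sum)
    hence "(X * B * P + Q) - Q = (P + Q) - Q" by simp
    moreover have "(M + Q) - Q = M" if "M \<in> carrier_mat n n" for M
      using that c by (intro eq_matI) auto
    ultimately have "X * B * P = P" using B c by simp
    thus ?thesis unfolding BX .
  qed
  have fix_B: "X * B * B = B" if "is_m_core_inverse n B X" for X
  proof -
    note X = facts[OF that]
    have "X * B * (B * X) * B = B * X * B" using proj[OF that] by simp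
    moreover have "X * B * (B * X) * B = X * B * (B * X * B)"
      using B X(1) by (intro assoc_mult_mat[of _ n n _ n _ n]) auto
    ultimately show ?thesis using X(2) by simp
  qed
  have absorb: "X * B * Y = Y" if XY: "is_m_core_inverse n B X" "is_m_core_inverse n B Y" for X Y
  proof -
    note X = facts[OF XY(1)] and Y = facts[OF XY(2)]
    have "X * B * (B * (Y * Y)) = X * B * B * (Y * Y)"
      using B X(1) Y(1) by (intro assoc_mult_mat[symmetric, of _ n n _ n _ n]) auto
    moreover have "B * (Y * Y) = Y" using Y(1,3) B by (simp add: assoc)
    ultimately show ?thesis using fix_B[OF XY(1)] by simp
  qed
  have eq: "B * X = B * Y"
  proof (rule minkowski_projectors_eq)
    have "B * U * (B * V) = B * V" if "is_m_core_inverse n B U" "is_m_core_inverse n B V" for U V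
    proof -
      have "B * U * (B * V) = B * U * B * V"
        using facts(1)[OF that(1)] facts(1)[OF that(2)] B
        by (intro assoc_mult_mat[symmetric, of _ n n _ n _ n]) auto
      thus ?thesis using facts(2)[OF that(1)] by simp
    qed
    thus "B * X * (B * Y) = B * Y" "B * Y * (B * X) = B * X" using assms(2,3) by auto
  qed (use B facts[OF assms(2)] facts[OF assms(3)] in auto)
  have "Y = X * (B * Y)"
    using absorb[OF assms(2,3)] B facts(1)[OF assms(2)] facts(1)[OF assms(3)] by (simp add: assoc)
  also have "\<dots> = X * (B * X)" using eq by simp
  also have "\<dots> = X"
    using absorb[OF assms(2,2)] B facts(1)[OF assms(2)] by (simp add: assoc)
  finally show ?thesis ..
qed

end

theory Submission
  imports Defs
begin

text \<open>
  The relation \<open>A2 * A1 = 0\<close> gives \<open>A * A1 = A1 * A1\<close>, and since \<open>A1\<close> and its square have the same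
  range, \<open>A1\<close> factors through every power of \<open>A\<close> on the left. Conversely, expanding \<open>A ^ k\<close> with
  \<open>A2 * A1 = 0\<close> and \<open>A2 ^ k = 0\<close> shows that \<open>A ^ k\<close>, and hence every m-core-EP inverse \<open>X\<close> of \<open>A\<close>,
  factors through \<open>A1\<close>. So \<open>A2 * X = 0\<close>, that is \<open>A * X = A1 * X\<close>, and this matrix
  fixes the range of \<open>A1\<close>; the equations of the m-core inverse of \<open>A1\<close> follow, and
  uniqueness of both inverses finishes the proof.
\<close>

text \<open>A maximal independent set of columns of \<open>B\<close> lies in
  \<open>col_space A\<close> and has as many elements as that space has dimensions. It is therefore
  a basis of \<open>col_space A\<close>, and its span stays inside
  \<open>col_space B\<close>.\<close>

lemma (in vec_space) col_space_eq_of_rank_eq: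
  assumes A: "A \<in> carrier_mat n p" and B: "B \<in> carrier_mat n q"
    and sub: "col_space B \<subseteq> col_space A" and rank: "rank B = rank A"
  shows "col_space B = col_space A"
proof
  have carr: "set (cols A) \<subseteq> carrier_vec n" "set (cols B) \<subseteq> carrier_vec n"
    using A B cols_dim by blast+
  obtain U where "finite U" and max: "maximal U (\<lambda>T. T \<subseteq> set (cols B) \<and> lin_indpt T)"
    using maximal_exists_superset[of "set (cols B)" "\<lambda>T. T \<subseteq> set (cols B) \<and> lin_indpt T" "{}"]
    by (auto simp: lin_dep_def)
  hence U: "U \<subseteq> set (cols B)" "lin_indpt U" by (auto simp: maximal_def)
  have card: "card U = rank A" using rank_card_indpt[OF B max] rank by simp
  \<comment> \<open>Viewed as a vector space of its own, \<open>col_space A\<close> admits the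
    dimension criterion for a basis. Span and independence of \<open>U\<close> are the same there as
    in the ambient space.\<close>
  have subspace: "VectorSpace.subspace class_ring (col_space A) V"
    unfolding col_space_def using carr(1) by (intro span_is_subspace) simp
  hence submodule: "submodule class_ring (col_space A) V" by (simp add: VectorSpace.subspace_def)
  interpret W: vectorspace class_ring "vs (col_space A)"
    using subspace by (rule subspace_is_vs)
  have "set (cols B) \<subseteq> col_space B"
    unfolding col_space_def using carr(2) by (intro in_own_span) simp
  hence UA: "U \<subseteq> col_space A" using U(1) sub by blast
  have "W.basis U"
  proof (rule W.dim_li_is_basis)
    show "W.fin_dim" unfolding col_space_def by (rule fin_dim_span_cols[OF A])
    show "\<not> LinearCombinations.module.lin_dep class_ring (vs (col_space A)) U"
      using span_li_not_depend(2)[OF UA submodule] U(2) by simp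
    show "W.dim \<le> card U" using card by (simp add: rank_def col_space_def)
  qed (use \<open>finite U\<close> UA in auto)
  hence "span U = col_space A"
    using span_li_not_depend(1)[OF UA submodule] by (simp add: W.basis_def)
  moreover have "span U \<subseteq> col_space B"
    unfolding col_space_def using U(1) by (rule span_is_monotone)
  ultimately show "col_space A \<subseteq> col_space B" by simp
qed (rule sub)

lemma (in vec_space) col_space_mult_subset:
  assumes A: "A \<in> carrier_mat n p" and B: "B \<in> carrier_mat p q"
  shows "col_space (A * B) \<subseteq> col_space A"
  using A B by (auto simp: col_space_eq[OF A] col_space_eq[OF mult_carrier_mat[OF A B]]
      intro!: bexI[of _ "B *\<^sub>v _"])

text \<open>Each column of \<open>B\<close> is \<open>A\<close> applied to some vector; the chosen
  vectors are the columns of \<open>Z\<close>. This turns range inclusions into matrix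
  equations.\<close>

lemma (in vec_space) col_space_factor:
  assumes A: "A \<in> carrier_mat n p" and B: "B \<in> carrier_mat n q"
    and sub: "col_space B \<subseteq> col_space A"
  obtains Z where "Z \<in> carrier_mat p q" "B = A * Z"
proof -
  have "\<exists>x. x \<in> carrier_vec p \<and> A *\<^sub>v x = col B j" if j: "j < q" for j
  proof -
    have "B *\<^sub>v unit_vec q j = col B j" using B j by (intro eq_vecI) auto
    hence "col B j \<in> col_space B"
      using B j by (auto simp: col_space_eq[OF B] intro!: bexI[of _ "unit_vec q j"])
    thus ?thesis using sub A by (auto simp: col_space_eq[OF A])
  qed
  then obtain f where f: "\<And>j. j < q \<Longrightarrow> f j \<in> carrier_vec p \<and> A *\<^sub>v f j = col B j" by metis
  define Z where "Z = mat_of_cols p (map f [0..<q])"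
  have Z: "Z \<in> carrier_mat p q" unfolding Z_def by (simp add: mat_of_cols_def)
  have "B = A * Z"
  proof (rule mat_col_eqI)
    fix j assume "j < dim_col (A * Z)"
    hence j: "j < q" using Z by simp
    have "col Z j = f j" unfolding Z_def using j f by (subst col_mat_of_cols) auto
    thus "col B j = col (A * Z) j" using col_mult2[OF A Z j] f[OF j] by simp
  qed (use A B Z in auto)
  with Z show thesis by (rule that)
qed

lemma pow_mat_commutes:
  assumes "A \<in> carrier_mat n n"
  shows "A * A ^\<^sub>m j = A ^\<^sub>m j * A"
proof (induction j)
  case (Suc j)
  have "A * A ^\<^sub>m Suc j = (A * A ^\<^sub>m j) * A"
    using assms by (simp add: assoc_mult_mat[of _ n n _ n _ n])
  thus ?case using Suc by simp
qed (use assms in simp)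

context
  fixes n :: nat and A A1 A2 :: "complex mat"
  assumes A1: "A1 \<in> carrier_mat n n" and A2: "A2 \<in> carrier_mat n n"
    and A: "A = A1 + A2" and A21: "A2 * A1 = 0\<^sub>m n n"
begin

private lemma A_carrier: "A \<in> carrier_mat n n"
  using A1 A2 A by simp

private lemmas assoc = assoc_mult_mat[of _ n n _ n _ n]

private lemma A_mult_A1: "A * A1 = A1 * A1"
  using A1 A2 A21 unfolding A by (simp add: add_mult_distrib_mat[of _ n n _ _ n])

text \<open>In the expansion of \<open>(A1 + A2) ^ j\<close> a word containing
  \<open>A2 * A1\<close> vanishes. Every surviving word other than \<open>A2 ^ j\<close> starts with
  \<open>A1\<close>.\<close>

lemma pow_eq_left_multiple_plus_pow:
  obtains M where "M \<in> carrier_mat n n" "A ^\<^sub>m j = A1 * M + A2 ^\<^sub>m j"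
proof -
  have "\<exists>M \<in> carrier_mat n n. A ^\<^sub>m j = A1 * M + A2 ^\<^sub>m j"
  proof (induction j)
    case 0
    show ?case using A1 A2 A by (intro bexI[of _ "0\<^sub>m n n"]) auto
  next
    case (Suc j)
    then obtain M where M: "M \<in> carrier_mat n n" "A ^\<^sub>m j = A1 * M + A2 ^\<^sub>m j" by blast
    have P: "A2 ^\<^sub>m j \<in> carrier_mat n n" using A2 by simp
    \<comment> \<open>The product vanishes only for positive \<open>j\<close>; for
      \<open>j = 0\<close> it is \<open>A1\<close> itself, so \<open>D\<close> is the zero or the
      identity matrix.\<close>
    obtain D where D: "D \<in> carrier_mat n n" "A2 ^\<^sub>m j * A1 = A1 * D"
    proof (cases j)
      case 0
      thus thesis using that[of "1\<^sub>m n"] A1 A2 by simp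
    next
      case (Suc i)
      thus thesis using that[of "0\<^sub>m n n"] A1 A2 A21 by (simp add: assoc)
    qed
    have "A ^\<^sub>m Suc j = A1 * M * A + A2 ^\<^sub>m j * A"
      using M P A1 A_carrier by (simp add: add_mult_distrib_mat[of _ n n _ _ n])
    also have "A2 ^\<^sub>m j * A = A1 * D + A2 ^\<^sub>m Suc j"
      using A1 A2 P D(2) by (simp add: A mult_add_distrib_mat[of _ n n _ n])
    also have "A1 * M * A + (A1 * D + A2 ^\<^sub>m Suc j) = A1 * M * A + A1 * D + A2 ^\<^sub>m Suc j"
      using A1 A2 A_carrier M D P by (intro assoc_add_mat[symmetric, of _ n n]) auto
    also have "A1 * M * A + A1 * D = A1 * (M * A + D)"
      using A1 A_carrier M D by (simp add: assoc mult_add_distrib_mat[of _ n n _ n])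
    finally show ?case using A_carrier M D by (intro bexI[of _ "M * A + D"]) auto
  qed
  thus thesis using that by blast
qed

text \<open>Equal ranks give \<open>A1 = A1 * A1 * Z = A * A1 * Z\<close>, and each substitution of
  this into itself gains one factor \<open>A\<close>. The factor \<open>A1\<close> kept in front of
  \<open>W\<close> is what the next substitution replaces.\<close>

lemma eq_pow_mult:
  assumes rank: "vec_space.rank n (A1 ^\<^sub>m 2) = vec_space.rank n A1"
  obtains W where "W \<in> carrier_mat n n" "A1 = A ^\<^sub>m j * (A1 * W)"
proof -
  interpret vec_space "TYPE(complex)" n .
  have sq: "A1 ^\<^sub>m 2 = A1 * A1" using A1 by (simp add: numeral_2_eq_2)
  have AA: "A1 * A1 \<in> carrier_mat n n" using A1 by simp
  have "col_space (A1 * A1) = col_space A1"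
    using rank A1 AA by (intro col_space_eq_of_rank_eq col_space_mult_subset) (auto simp: sq)
  then obtain Z where Z: "Z \<in> carrier_mat n n" "A1 = A1 * A1 * Z"
    using col_space_factor[OF AA A1] by auto
  have "\<exists>W \<in> carrier_mat n n. A1 = A ^\<^sub>m j * (A1 * W)"
  proof (induction j)
    case 0
    show ?case using A1 A_carrier by (intro bexI[of _ "1\<^sub>m n"]) auto
  next
    case (Suc j)
    then obtain W where W: "W \<in> carrier_mat n n" "A1 = A ^\<^sub>m j * (A1 * W)" by blast
    have "A1 * W = A * A1 * Z * W" using Z(2) A_mult_A1 by simp
    hence "A1 = A ^\<^sub>m j * (A * A1 * Z * W)" using W(2) by simp
    also have "\<dots> = A ^\<^sub>m Suc j * (A1 * (Z * W))"
      using A1 A_carrier Z(1) W(1) by (simp add: assoc)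
    finally show ?case using Z(1) W(1) by (intro bexI[of _ "Z * W"]) auto
  qed
  thus thesis using that by blast
qed

lemma m_core_EP_inverse_imp_m_core_inverse:
  assumes rank: "vec_space.rank n (A1 ^\<^sub>m 2) = vec_space.rank n A1"
    and nil: "A2 ^\<^sub>m mat_Ind n A = 0\<^sub>m n n"
    and "is_m_core_EP_inverse n A X"
  shows "is_m_core_inverse n A1 X"
proof -
  interpret vec_space "TYPE(complex)" n .
  define k where "k = mat_Ind n A"
  have X: "X \<in> carrier_mat n n" "X * A ^\<^sub>m Suc k = A ^\<^sub>m k"
    "minkowski_adjoint n (A * X) = A * X" "col_space X \<subseteq> col_space (A ^\<^sub>m k)"
    using assms(3) by (auto simp: is_m_core_EP_inverse_def k_def)
  have pow: "A ^\<^sub>m i \<in> carrier_mat n n" for i using A_carrier by simp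
  obtain M where M: "M \<in> carrier_mat n n" "A ^\<^sub>m k = A1 * M"
    using pow_eq_left_multiple_plus_pow[of k] nil A1 by (auto simp: k_def)
  obtain V where V: "V \<in> carrier_mat n n" "X = A ^\<^sub>m k * V"
    using col_space_factor[OF pow X(1,4)] .
  define Q where "Q = M * V"
  have Q: "Q \<in> carrier_mat n n" "X = A1 * Q"
    using M V A1 by (auto simp: Q_def assoc)
  have "A2 * X = 0\<^sub>m n n"
    using Q A1 A2 A21 assoc_mult_mat[of A2 n n A1 n Q n] by simp
  hence AX: "A * X = A1 * X"
    using A1 A2 X(1) unfolding A by (simp add: add_mult_distrib_mat[of _ n n _ _ n])
  \<comment> \<open>The exponent is \<open>k + 1\<close> so that
    \<open>X * A ^ (k + 1) = A ^ k\<close> applies to \<open>X * A1\<close>; multiplying by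
    \<open>A\<close> on the left then restores the lost factor.\<close>
  obtain W where W: "W \<in> carrier_mat n n" "A1 = A ^\<^sub>m Suc k * (A1 * W)"
    using eq_pow_mult[OF rank] .
  have AW: "A1 * W \<in> carrier_mat n n" using A1 W(1) by simp
  have "X * A1 = X * A ^\<^sub>m Suc k * (A1 * W)"
    using W(2) assoc_mult_mat[OF X(1) pow AW] by metis
  hence "A * X * A1 = A * (A ^\<^sub>m k * (A1 * W))"
    using X(1,2) A_carrier A1 by (simp add: assoc)
  also have "\<dots> = A ^\<^sub>m Suc k * (A1 * W)"
    using assoc_mult_mat[OF A_carrier pow AW] by (simp add: pow_mat_commutes[OF A_carrier])
  finally have AXA1: "A1 * X * A1 = A1" using W(2) AX by simp
  \<comment> \<open>Writing the second factor \<open>X\<close> as \<open>A1 * Q\<close> lets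
    \<open>A1 * X\<close> act on \<open>A1\<close>, which it fixes.\<close>
  have "A1 * X ^\<^sub>m 2 = A1 * X * (A1 * Q)"
    using A1 X(1) Q(2) by (simp add: numeral_2_eq_2 assoc)
  also have "\<dots> = A1 * X * A1 * Q" using A1 X(1) Q(1) by (simp add: assoc)
  finally have "A1 * X ^\<^sub>m 2 = X" using AXA1 Q(2) by simp
  thus ?thesis unfolding is_m_core_inverse_def using rank X(1,3) AXA1 AX by simp
qed

end

theorem theorem2p7:
  fixes A A1 A2 :: "complex mat" and n :: nat
  assumes "n \<ge> 1"
    and "A \<in> carrier_mat n n"
    and "core_EP_decomposition n A A1 A2"
    and "\<exists>X. is_m_core_EP_inverse n A X"
  shows "(\<exists>Y. is_m_core_inverse n A1 Y) \<and> m_core_EP_inverse n A = m_core_inverse n A1"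
proof -
  obtain X where X: "is_m_core_EP_inverse n A X" using assms(4) by blast
  have A1: "A1 \<in> carrier_mat n n" using assms(3) by (simp add: core_EP_decomposition_def)
  \<comment> \<open>One matrix \<open>X\<close> witnesses both notions, so uniqueness makes both
    definite descriptions equal to it.\<close>
  have Y: "is_m_core_inverse n A1 X"
    using assms(3) X unfolding core_EP_decomposition_def
    by (blast intro: m_core_EP_inverse_imp_m_core_inverse)
  have "m_core_EP_inverse n A = X"
    unfolding m_core_EP_inverse_def
    using X m_core_EP_inverse_unique[OF assms(2)] by (intro the_equality) auto
  moreover have "m_core_inverse n A1 = X"
    unfolding m_core_inverse_def
    using Y m_core_inverse_unique[OF A1] by (intro the_equality) auto
  ultimately show ?thesis using Y by auto
qed

end
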